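(* Let $\widehat{\mathrm{CI}}^{\mathtt{GHulC}}_{N,\alpha}$ be the GHulC confidence interval (described in the context) with $\alpha\in(0,1)$, using $B\ge\log_2(2/\alpha)$ splits of (approximately) equal size $N/B$. Let $\widehat\theta^m$ denote the estimator of $\theta_0$ based on a sample of size $m$ and let $r_m>0$ be its rate of convergence, i.e. $r_m(\widehat\theta^m-\theta_0)=O_p(1)$ as $m\to\infty$. Let $\widetilde F_{N/B}$ be the common distribution function of $r_{N/B}(\widehat\theta_j-\theta_0)$, $1\le j\le B$, where $\widehat\theta_j$ is the estimator from the $j$-th split. Suppose that for some $\rho,\mathscr{C},\widetilde\Delta>0$, $$|\widetilde F_{N/B}(x)-\widetilde F_{N/B}(0)|>\mathscr{C}|x|^\rho\quad\text{for all } 0<|x|<\widetilde\Delta,$$ and let $\mathcal{E}_B\ge0$ satisfy $|\widetilde F_{N/B}(0)-1/2|\le\mathcal{E}_B$. Then for $\delta\in(0,1)$, with probability at least $1-\delta$, $$\mathrm{Width}\left(\widehat{\mathrm{CI}}^{\mathtt{GHulC}}_{N,\alpha}\right)\le\frac{2}{\mathscr{C}^{1/\rho}r_{N/B}}\left\{\frac{5\log(2/\delta)+\sqrt{2\log(2/\alpha)}}{2\sqrt B}+\frac2B+\mathcal{E}_B\right\}^{1/\rho},$$ provided $B$ is large enough that the right-hand side is less than $2\widetilde\Delta/r_{N/B}$.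
   Context: GHulC procedure. Inputs: i.i.d. observations $W_1,\dots,W_N$, level $\alpha$, an estimation procedure $\mathcal{A}$ mapping a finite data set to a real number, and a number of batches $B\ge\log_2(2/\alpha)$. (1) Split the data into $B$ disjoint sets of (approximately) equal size $N/B$ (independently of the data values). (2) Compute $\widehat\theta_j$ by applying $\mathcal{A}$ to the $j$-th set; the $\widehat\theta_j$ are i.i.d.; let $\widehat\theta_{(1)}\le\dots\le\widehat\theta_{(B)}$ be their order statistics. (3) With $Y_B\sim\mathrm{Bin}(B,1/2)$, let $c_{B,\alpha}$ be the smallest integer $x$ with $\mathbb{P}(Y_B\ge\lfloor B/2\rfloor-x)\ge1-\alpha/2$. (4) Let $P(n,k)=\sum_{i=\lfloor n/2\rfloor-k}^{\lceil n/2\rceil+k}\binom{n}{i}2^{-n}$ (an empty sum is $0$) and $\tau_\alpha=\frac{P(B,c_{B,\alpha})-(1-\alpha)}{P(B,c_{B,\alpha})-P(B,c_{B,\alpha}-1)}$. Draw $U\sim\mathrm{Uniform}(0,1)$ independent of the data, and set $c^*_{B,\alpha}=c_{B,\alpha}-1$ if $U\le\tau_\alpha$ and $c^*_{B,\alpha}=c_{B,\alpha}$ if $U>\tau_\alpha$. (5) Return $\widehat{\mathrm{CI}}^{\mathtt{GHulC}}_{N,\alpha}=\left[\widehat\theta_{(\lfloor B/2\rfloor-c^*_{B,\alpha})},\ \widehat\theta_{(\lceil B/2\rceil+c^*_{B,\alpha}+1)}\right]$ (the empty set, of width $0$, if the lower index exceeds the upper index). Width denotes the length of the interval. *)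

theory Defs
  imports "HOL-Probability.Probability"
begin

text \<open>Stochastic boundedness \<open>X m = O\<^sub>p(1)\<close> as \<open>m\<close> tends to infinity; the \<open>m\<close>-th variable lives
  on its own probability space \<open>Q m\<close>.\<close>

definition bounded_in_prob :: "(nat \<Rightarrow> 'c measure) \<Rightarrow> (nat \<Rightarrow> 'c \<Rightarrow> real) \<Rightarrow> bool" where
  "bounded_in_prob Q X \<longleftrightarrow>
     (\<forall>\<epsilon>>0. \<exists>K. \<forall>\<^sub>F m in sequentially.
        measure (Q m) {w \<in> space (Q m). \<bar>X m w\<bar> > K} \<le> \<epsilon>)"

text \<open>Independence of two random variables. The library constant \<open>indep_var\<close> only covers variables with
  values in the same type; this is the right-hand side of its characterisation \<open>indep_var_eq\<close>.\<close>

definition indep_rv ::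
    "'a measure \<Rightarrow> 'b measure \<Rightarrow> ('a \<Rightarrow> 'b) \<Rightarrow> 'c measure \<Rightarrow> ('a \<Rightarrow> 'c) \<Rightarrow> bool" where
  "indep_rv M S X T Y \<longleftrightarrow>
     X \<in> measurable M S \<and> Y \<in> measurable M T \<and>
     prob_space.indep_set M
       (sigma_sets (space M) {X -` A \<inter> space M | A. A \<in> sets S})
       (sigma_sets (space M) {Y -` A \<inter> space M | A. A \<in> sets T})"

text \<open>A split is a list of \<open>B\<close> batches, each batch being the list of the indices of its observations.
  The order inside a batch matters only for procedures that are not symmetric in the data.
  Approximately equal size means that each size is \<open>N / B\<close> rounded down or up.\<close>

definition splits :: "nat \<Rightarrow> nat \<Rightarrow> nat list list set" where
  "splits N B = {g. length g = B \<and> distinct (concat g) \<and> set (concat g) = {..<N} \<and>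
     (\<forall>I \<in> set g. length I \<in> {nat \<lfloor>real N / real B\<rfloor>, nat \<lceil>real N / real B\<rceil>})}"

definition batch_estimates :: "('w list \<Rightarrow> real) \<Rightarrow> (nat \<Rightarrow> 'w) \<Rightarrow> nat list list \<Rightarrow> real list" where
  "batch_estimates A x g = map (\<lambda>I. A (map x I)) g"

text \<open>The order statistics are numbered from 1.\<close>

definition order_stat :: "real list \<Rightarrow> int \<Rightarrow> real" where
  "order_stat xs k = sort xs ! nat (k - 1)"

definition ghulc_c :: "nat \<Rightarrow> real \<Rightarrow> int" where
  "ghulc_c B \<alpha> = (LEAST x::int.
     measure_pmf.prob (binomial_pmf B (1 / 2)) {y. int y \<ge> \<lfloor>real B / 2\<rfloor> - x} \<ge> 1 - \<alpha> / 2)"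

text \<open>Summing over natural numbers \<open>i\<close> amounts to the convention that binomial coefficients with
  a negative lower index vanish.\<close>

definition ghulc_P :: "nat \<Rightarrow> int \<Rightarrow> real" where
  "ghulc_P n k = (\<Sum>i | \<lfloor>real n / 2\<rfloor> - k \<le> int i \<and> int i \<le> \<lceil>real n / 2\<rceil> + k.
     real (n choose i) / 2 ^ n)"

definition ghulc_tau :: "nat \<Rightarrow> real \<Rightarrow> real" where
  "ghulc_tau B \<alpha> =
     (ghulc_P B (ghulc_c B \<alpha>) - (1 - \<alpha>)) /
     (ghulc_P B (ghulc_c B \<alpha>) - ghulc_P B (ghulc_c B \<alpha> - 1))"

definition ghulc_cstar :: "nat \<Rightarrow> real \<Rightarrow> real \<Rightarrow> int" where
  "ghulc_cstar B \<alpha> u = (if u \<le> ghulc_tau B \<alpha> then ghulc_c B \<alpha> - 1 else ghulc_c B \<alpha>)"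

definition ghulc_CI :: "real \<Rightarrow> real \<Rightarrow> real list \<Rightarrow> real set" where
  "ghulc_CI \<alpha> u \<theta>s =
     (let B = length \<theta>s;
          c = ghulc_cstar B \<alpha> u;
          lo = \<lfloor>real B / 2\<rfloor> - c;
          hi = \<lceil>real B / 2\<rceil> + c + 1
      in if lo \<le> hi then {order_stat \<theta>s lo .. order_stat \<theta>s hi} else {})"

definition width :: "real set \<Rightarrow> real" where
  "width I = measure lborel I"

end

theory Submission
  imports Defs
begin

text \<open>Since \<open>c\<^sup>*\<close> is at most \<open>c = ghulc_c B \<alpha>\<close>, the interval lies between the order statistics with numbers
  \<open>lo = \<lfloor>B / 2\<rfloor> - c\<close> and \<open>hi = \<lceil>B / 2\<rceil> + c + 1\<close>, whatever \<open>U\<close> is; the binomial tail bound gives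
  \<open>c \<le> sqrt (B ln (2 / \<alpha>) / 2)\<close>. For \<open>t\<close> with \<open>C t\<^sup>\<rho> = \<eta>\<close>, where \<open>\<eta>\<close> is the expression in braces, the growth
  condition makes \<open>B F(t)\<close> exceed \<open>hi\<close>, and \<open>lo\<close> exceed \<open>B F(-t)\<close>, by a multiple of \<open>sqrt B ln (2 / \<delta>)\<close>. So by
  Hoeffding's inequality, outside an event of probability \<open>\<delta>\<close>, at least \<open>hi\<close> estimates are at most
  \<open>\<theta>\<^sub>0 + t / r\<close> and fewer than \<open>lo\<close> are at most \<open>\<theta>\<^sub>0 - t / r\<close>.

  The estimates need not be i.i.d. when the batch sizes differ. But given the split they are independent,
  and the average of their conditional distribution functions is the same for every split, hence
  equal to \<open>F\<close>; this is all that Hoeffding's inequality needs.\<close>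

section \<open>The binomial tail and the size of \<open>ghulc_c\<close>\<close>

text \<open>The integers are not well-ordered, so \<open>LEAST\<close> is meaningful only for a
  predicate with a lower bound; subtracting \<open>k\<close> reduces the claim to the natural
  numbers.\<close>

lemma int_Least_le:
  fixes x k :: int
  assumes "Q x" and bound: "\<And>y. Q y \<Longrightarrow> k \<le> y"
  shows "(LEAST y. Q y) \<le> x"
proof -
  define n where "n = (LEAST n. Q (k + int n))"
  have lift: "Q y \<Longrightarrow> Q (k + int (nat (y - k)))" for y
    using bound[of y] by simp
  have "Q (k + int n)"
    unfolding n_def using lift[OF \<open>Q x\<close>] by (rule LeastI)
  moreover have least: "k + int n \<le> y" if "Q y" for y
  proof -
    have "n \<le> nat (y - k)"
      unfolding n_def using lift[OF that] by (rule Least_le)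
    then show ?thesis using bound[OF that] by linarith
  qed
  ultimately have "(LEAST y. Q y) = k + int n"
    by (rule Least_equality)
  with least[OF \<open>Q x\<close>] show ?thesis by simp
qed

text \<open>Hoeffding's bound for Bin(B, 1/2) makes the probability of falling \<open>s\<close>
  below the mean at most \<open>exp (- 2 * s\<^sup>2 / B)\<close>; this \<open>s\<close> is chosen
  so that the bound equals \<open>\<alpha> / 2\<close>. Hence the integer part of \<open>s\<close>
  already qualifies in the definition of \<open>ghulc_c\<close>.\<close>

lemma ghulc_c_le:
  assumes "B > 0" "0 < \<alpha>" "\<alpha> < 1"
  shows "real_of_int (ghulc_c B \<alpha>) \<le> sqrt (real B * ln (2 / \<alpha>) / 2)"
proof -
  interpret binomial_distribution B "1 / 2" by standard simp
  let ?Y = "binomial_pmf B (1 / 2)"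
  define s where "s = sqrt (real B * ln (2 / \<alpha>) / 2)"
  have s2: "s\<^sup>2 = real B * ln (2 / \<alpha>) / 2" and "s \<ge> 0"
    using assms by (simp_all add: s_def)
  have "ghulc_c B \<alpha> \<le> \<lfloor>s\<rfloor>"
    unfolding ghulc_c_def
  proof (rule int_Least_le)
    let ?A = "{y. int y \<ge> \<lfloor>real B / 2\<rfloor> - \<lfloor>s\<rfloor>}"
    have "measure_pmf.prob ?Y (UNIV - ?A) \<le> measure_pmf.prob ?Y {y. real y \<le> real B * (1 / 2) - s}"
    proof (rule measure_pmf.finite_measure_mono)
      show "UNIV - ?A \<subseteq> {y. real y \<le> real B * (1 / 2) - s}"
      proof
        fix y assume "y \<in> UNIV - ?A"
        \<comment> \<open>The unit gained from a strict inequality between integers absorbs the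
          rounding of \<open>s\<close>.\<close>
        then have "int y + 1 \<le> \<lfloor>real B / 2\<rfloor> - \<lfloor>s\<rfloor>" by simp
        then have "real y + 1 \<le> real_of_int \<lfloor>real B / 2\<rfloor> - real_of_int \<lfloor>s\<rfloor>" by linarith
        then show "y \<in> {y. real y \<le> real B * (1 / 2) - s}"
          using of_int_floor_le[of "real B / 2"] by simp linarith
      qed
    qed simp
    also have "\<dots> \<le> exp (- 2 * s\<^sup>2 / real B)"
      using assms \<open>s \<ge> 0\<close> by (intro prob_le) auto
    also have "\<dots> = exp (- ln (2 / \<alpha>))"
      using assms by (simp add: s2)
    also have "\<dots> = \<alpha> / 2"
      using assms by (simp add: exp_minus)
    finally show "measure_pmf.prob ?Y ?A \<ge> 1 - \<alpha> / 2"
      using measure_pmf.prob_compl[of ?A ?Y] by simp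
  next
    fix x :: int
    assume *: "measure_pmf.prob ?Y {y. int y \<ge> \<lfloor>real B / 2\<rfloor> - x} \<ge> 1 - \<alpha> / 2"
    \<comment> \<open>For smaller \<open>x\<close> the event asks for more than \<open>B\<close>
      successes, so it has probability 0.\<close>
    show "\<lfloor>real B / 2\<rfloor> - int B \<le> x"
    proof (rule ccontr)
      assume "\<not> ?thesis"
      then have "set_pmf ?Y \<inter> {y. int y \<ge> \<lfloor>real B / 2\<rfloor> - x} = {}"
        by auto
      then have "measure_pmf.prob ?Y {y. int y \<ge> \<lfloor>real B / 2\<rfloor> - x} = 0"
        by (simp add: measure_pmf_zero_iff)
      with * assms show False by simp
    qed
  qed
  then show ?thesis
    using of_int_floor_le[of s] unfolding s_def by linarith
qed

section \<open>Order statistics and the width of the interval\<close>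

text \<open>In the sorted list the entries at most \<open>y\<close> form an initial segment, and
  sorting does not change their number. This turns statements about order statistics into statements
  about counts.\<close>

lemma order_stat_le_iff:
  assumes "1 \<le> k" "k \<le> int (length xs)"
  shows "order_stat xs k \<le> y \<longleftrightarrow> k \<le> int (card {j. j < length xs \<and> xs ! j \<le> y})"
proof -
  let ?s = "sort xs"
  let ?S = "{j. j < length ?s \<and> ?s ! j \<le> y}"
  have card: "card {j. j < length xs \<and> xs ! j \<le> y} = card ?S"
    using length_filter_conv_card[of "\<lambda>x. x \<le> y" xs] length_filter_conv_card[of "\<lambda>x. x \<le> y" ?s]
    by (simp add: filter_sort)
  define i where "i = nat (k - 1)"
  have i: "i < length ?s" "k = int i + 1"
    using assms by (auto simp: i_def)
  have "?s ! i \<le> y \<longleftrightarrow> i < card ?S"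
  proof
    assume le: "?s ! i \<le> y"
    have "{..i} \<subseteq> ?S"
    proof
      fix j assume "j \<in> {..i}"
      then have "?s ! j \<le> ?s ! i"
        using i by (intro sorted_nth_mono) auto
      with le show "j \<in> ?S" using \<open>j \<in> {..i}\<close> i by auto
    qed
    then have "card {..i} \<le> card ?S"
      by (intro card_mono) auto
    then show "i < card ?S" by simp
  next
    assume less: "i < card ?S"
    show "?s ! i \<le> y"
    proof (rule ccontr)
      assume gt: "\<not> ?s ! i \<le> y"
      have "?S \<subseteq> {..<i}"
      proof
        fix j assume j: "j \<in> ?S"
        show "j \<in> {..<i}"
        proof (rule ccontr)
          assume "j \<notin> {..<i}"
          then have "?s ! i \<le> ?s ! j"
            using j by (intro sorted_nth_mono) auto
          with j gt show False by simp
        qed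
      qed
      then have "card ?S \<le> card {..<i}"
        by (intro card_mono) auto
      with less show False by simp
    qed
  qed
  then show ?thesis
    unfolding order_stat_def card i_def[symmetric] using i(2) by auto
qed

lemma order_stat_mono:
  assumes "1 \<le> k" "k \<le> l" "l \<le> int (length xs)"
  shows "order_stat xs k \<le> order_stat xs l"
  unfolding order_stat_def using assms by (intro sorted_nth_mono) auto

lemma width_ghulc_CI:
  fixes \<alpha> u xs
  defines "c \<equiv> ghulc_cstar (length xs) \<alpha> u"
  defines "lo \<equiv> \<lfloor>real (length xs) / 2\<rfloor> - c" and "hi \<equiv> \<lceil>real (length xs) / 2\<rceil> + c + 1"
  assumes "1 \<le> lo" "hi \<le> int (length xs)"
  shows "width (ghulc_CI \<alpha> u xs) = (if lo \<le> hi then order_stat xs hi - order_stat xs lo else 0)"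
proof -
  have "ghulc_CI \<alpha> u xs = (if lo \<le> hi then {order_stat xs lo .. order_stat xs hi} else {})"
    by (simp add: ghulc_CI_def Let_def lo_def hi_def c_def)
  then show ?thesis
    using assms order_stat_mono[of lo hi xs] by (simp add: width_def)
qed

lemma ghulc_cstar_le: "ghulc_cstar B \<alpha> u \<le> ghulc_c B \<alpha>"
  by (simp add: ghulc_cstar_def)

text \<open>The counts refer to the non-random \<open>ghulc_c\<close>. Passing to the smaller
  \<open>ghulc_cstar\<close> only moves both indices inwards, so the two endpoints stay between
  \<open>a\<close> and \<open>b\<close>; if the indices cross, the width is 0 and
  \<open>a \<le> b\<close> suffices.\<close>

lemma width_ghulc_CI_le:
  fixes \<alpha> u xs
  defines "B \<equiv> length xs"
  assumes lo: "\<lfloor>real B / 2\<rfloor> - ghulc_c B \<alpha> \<ge> 1"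
    and hi: "\<lceil>real B / 2\<rceil> + ghulc_c B \<alpha> + 1 \<le> int B"
    and "a \<le> b"
    and few: "int (card {j. j < B \<and> xs ! j \<le> a}) < \<lfloor>real B / 2\<rfloor> - ghulc_c B \<alpha>"
    and many: "int (card {j. j < B \<and> xs ! j \<le> b}) \<ge> \<lceil>real B / 2\<rceil> + ghulc_c B \<alpha> + 1"
  shows "width (ghulc_CI \<alpha> u xs) \<le> b - a"
proof -
  define l where "l = \<lfloor>real B / 2\<rfloor> - ghulc_cstar B \<alpha> u"
  define h where "h = \<lceil>real B / 2\<rceil> + ghulc_cstar B \<alpha> u + 1"
  have lh: "\<lfloor>real B / 2\<rfloor> - ghulc_c B \<alpha> \<le> l" "h \<le> \<lceil>real B / 2\<rceil> + ghulc_c B \<alpha> + 1"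
    using ghulc_cstar_le[of B \<alpha> u] by (simp_all add: l_def h_def)
  have eq: "width (ghulc_CI \<alpha> u xs) = (if l \<le> h then order_stat xs h - order_stat xs l else 0)"
    unfolding l_def h_def B_def
    by (rule width_ghulc_CI) (use lo hi lh in \<open>auto simp: l_def h_def B_def\<close>)
  show ?thesis
  proof (cases "l \<le> h")
    case True
    have "order_stat xs h \<le> b"
      using many lh lo hi True by (subst order_stat_le_iff) (auto simp: B_def)
    moreover have "\<not> order_stat xs l \<le> a"
      using few lh lo hi True by (subst order_stat_le_iff) (auto simp: B_def)
    ultimately show ?thesis using eq True by simp
  next
    case False
    then show ?thesis using eq \<open>a \<le> b\<close> by simp
  qed
qed

text \<open>Sublevel sets are described by a count of entries, which is a finite sum of measurable
  indicators; measurability of sorting never has to be discussed.\<close>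

lemma borel_measurable_order_stat:
  assumes [measurable]: "\<And>j. j < B \<Longrightarrow> (\<lambda>\<omega>. T \<omega> ! j) \<in> borel_measurable M"
    and len: "\<And>\<omega>. \<omega> \<in> space M \<Longrightarrow> length (T \<omega>) = B"
    and k: "1 \<le> k" "k \<le> int B"
  shows "(\<lambda>\<omega>. order_stat (T \<omega>) k) \<in> borel_measurable M"
proof (subst borel_measurable_iff_le, rule allI)
  fix y
  have "{\<omega> \<in> space M. order_stat (T \<omega>) k \<le> y} =
    {\<omega> \<in> space M. real_of_int k \<le> (\<Sum>j<B. if T \<omega> ! j \<le> y then 1 else 0)}"
  proof (rule Collect_cong, rule conj_cong[OF refl])
    fix \<omega> assume "\<omega> \<in> space M"
    have "(\<Sum>j<B. if T \<omega> ! j \<le> y then 1 else 0 :: real) = real (card {j. j < B \<and> T \<omega> ! j \<le> y})"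
      by (simp add: sum.If_cases Int_def)
    then show "order_stat (T \<omega>) k \<le> y \<longleftrightarrow>
        real_of_int k \<le> (\<Sum>j<B. if T \<omega> ! j \<le> y then 1 else 0)"
      using k len[OF \<open>\<omega> \<in> space M\<close>] by (subst order_stat_le_iff) auto
  qed
  also have "\<dots> \<in> sets M" by measurable
  finally show "{\<omega> \<in> space M. order_stat (T \<omega>) k \<le> y} \<in> sets M" .
qed

section \<open>Splits of the index set\<close>

lemma splitsD:
  assumes "g \<in> splits N B" "j < B"
  shows "length g = B" "distinct (g ! j)" "set (g ! j) \<subseteq> {..<N}"
  using assms by (auto simp: splits_def distinct_concat_iff)

text \<open>Finiteness lets conditioning on the random split be written as a finite sum.
  Distinctness of the indices bounds the length of each batch by \<open>N\<close>.\<close>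

lemma finite_splits: "finite (splits N B)"
proof (rule finite_subset)
  let ?L = "{I. set I \<subseteq> {..<N} \<and> length I \<le> N}"
  show "splits N B \<subseteq> {g. set g \<subseteq> ?L \<and> length g = B}"
  proof
    fix g assume g: "g \<in> splits N B"
    have "I \<in> ?L" if "I \<in> set g" for I
    proof -
      have "length g = B" using g by (simp add: splits_def)
      with that obtain j where j: "j < B" "I = g ! j"
        by (metis in_set_conv_nth)
      then show ?thesis
        using splitsD(2,3)[OF g j(1)] card_mono[of "{..<N}" "set I"]
        by (simp add: distinct_card)
    qed
    then show "g \<in> {g. set g \<subseteq> ?L \<and> length g = B}"
      using g by (auto simp: splits_def)
  qed
  show "finite {g. set g \<subseteq> ?L \<and> length g = B}"
    by (intro finite_lists_length_eq finite_lists_length_le) auto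
qed

lemma splits_disjoint:
  assumes g: "g \<in> splits N B"
  shows "disjoint_family_on (\<lambda>j. set (g ! j)) {..<B}"
  unfolding disjoint_family_on_def
proof (intro ballI impI)
  fix i j assume "i \<in> {..<B}" "j \<in> {..<B}" "i \<noteq> j"
  then show "set (g ! i) \<inter> set (g ! j) = {}"
  proof (induction i j rule: linorder_wlog)
    case (le i j)
    have len: "length g = B" and d: "distinct (concat g)"
      using g by (auto simp: splits_def)
    \<comment> \<open>With \<open>i < j\<close>, batch \<open>i\<close> lies in the prefix before
      batch \<open>j\<close>, and the concatenation has no repeated index.\<close>
    have "g = take j g @ g ! j # drop (Suc j) g"
      using le len by (simp add: id_take_nth_drop)
    then have "concat g = concat (take j g) @ g ! j @ concat (drop (Suc j) g)"
      by (metis concat.simps(2) concat_append)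
    with d have "set (concat (take j g)) \<inter> set (g ! j) = {}"
      by auto
    moreover have "g ! i \<in> set (take j g)"
      using le len by (auto simp: in_set_conv_nth intro!: exI[of _ i])
    ultimately show ?case by auto
  qed auto
qed

text \<open>The batch sizes take at most two consecutive values, on which any \<open>f\<close> agrees with an affine
  function. So, although the sizes may differ between batches, their sum of \<open>f\<close> is the same for
  every split.\<close>

lemma sum_splits:
  fixes f :: "nat \<Rightarrow> real"
  assumes g: "g \<in> splits N B"
  defines "q \<equiv> nat \<lfloor>real N / real B\<rfloor>"
  shows "(\<Sum>j<B. f (length (g ! j))) =
    real B * f q + (f (Suc q) - f q) * (real N - real B * real q)"
proof -
  have len: "length g = B" and d: "distinct (concat g)" and un: "set (concat g) = {..<N}"
    and sz: "\<And>I. I \<in> set g \<Longrightarrow> length I \<in> {q, nat \<lceil>real N / real B\<rceil>}"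
    using g by (auto simp: splits_def q_def)
  have "nat \<lceil>real N / real B\<rceil> \<in> {q, Suc q}"
    unfolding q_def by simp linarith
  \<comment> \<open>If both admissible sizes coincide, the slope is multiplied by 0, so the value of
    \<open>f\<close> at \<open>Suc q\<close> does no harm.\<close>
  then have aff: "f (length (g ! j)) = f q + (f (Suc q) - f q) * (real (length (g ! j)) - real q)"
    if "j < B" for j
    using sz[of "g ! j"] that len by auto
  have "N = length (concat g)"
    using d un by (metis card_lessThan distinct_card)
  also have "\<dots> = (\<Sum>j<B. length (g ! j))"
    by (simp add: length_concat sum_list_sum_nth len atLeast0LessThan)
  finally have "real N = (\<Sum>j<B. real (length (g ! j)))"
    by simp
  moreover have "(\<Sum>j<B. f (length (g ! j))) =
      (\<Sum>j<B. f q + (f (Suc q) - f q) * (real (length (g ! j)) - real q))"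
    using aff by (intro sum.cong) auto
  ultimately show ?thesis
    by (simp add: sum.distrib sum_subtractf flip: sum_distrib_left)
qed

section \<open>Concentration of counts and conditioning on the split\<close>

text \<open>The count is a sum of independent indicators with range [0, 1]. Their laws may differ,
  so the centre is the sum of the individual probabilities.\<close>

lemma (in prob_space) Hoeffding_count:
  fixes X :: "'i \<Rightarrow> 'a \<Rightarrow> real" and y :: real
  assumes indep: "indep_vars (\<lambda>_. borel) X I" and I: "finite I" "I \<noteq> {}" and "\<epsilon> \<ge> 0"
  defines "\<mu> \<equiv> (\<Sum>i\<in>I. prob {\<omega> \<in> space M. X i \<omega> \<le> y})"
  shows "prob {\<omega> \<in> space M. real (card {i \<in> I. X i \<omega> \<le> y}) \<le> \<mu> - \<epsilon>}
      \<le> exp (- 2 * \<epsilon>\<^sup>2 / real (card I))" (is ?le)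
    and "prob {\<omega> \<in> space M. real (card {i \<in> I. X i \<omega> \<le> y}) \<ge> \<mu> + \<epsilon>}
      \<le> exp (- 2 * \<epsilon>\<^sup>2 / real (card I))" (is ?ge)
proof -
  define Z where "Z = (\<lambda>i \<omega>. indicator {..y} (X i \<omega>) :: real)"
  have [measurable]: "X i \<in> borel_measurable M" if "i \<in> I" for i
    using indep that by (auto simp: indep_vars_def)
  have EZ: "expectation (Z i) = prob {\<omega> \<in> space M. X i \<omega> \<le> y}" if "i \<in> I" for i
  proof -
    have "expectation (Z i) = expectation (indicator {\<omega> \<in> space M. X i \<omega> \<le> y})"
      by (intro Bochner_Integration.integral_cong) (auto simp: Z_def indicator_def)
    then show ?thesis by (simp add: Int_def conj_commute)
  qed
  interpret Hoeffding_ineq M I Z "\<lambda>_. 0" "\<lambda>_. 1" \<mu>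
  proof unfold_locales
    show "indep_vars (\<lambda>_. borel) Z I"
      unfolding Z_def by (rule indep_vars_compose2[OF indep]) auto
    show "\<mu> \<equiv> \<Sum>i\<in>I. expectation (Z i)"
      by (simp add: \<mu>_def EZ)
  qed (auto simp: I Z_def indicator_def)
  have cnt: "(\<Sum>i\<in>I. Z i \<omega>) = real (card {i \<in> I. X i \<omega> \<le> y})" for \<omega>
    using I by (simp add: Z_def indicator_def sum.If_cases Int_def)
  have pos: "(\<Sum>i\<in>I. (1 - 0 :: real)\<^sup>2) > 0"
    using I by (simp add: card_gt_0_iff)
  show ?le using Hoeffding_ineq_le[OF \<open>\<epsilon> \<ge> 0\<close> pos] by (simp add: cnt)
  show ?ge using Hoeffding_ineq_ge[OF \<open>\<epsilon> \<ge> 0\<close> pos] by (simp add: cnt)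
qed

text \<open>Law of total probability over the finitely many values of \<open>G\<close>: by
  independence, fixing \<open>G\<close> leaves the law of \<open>X\<close> unchanged.\<close>

lemma (in prob_space) prob_indep_rv_mixture:
  assumes indep: "indep_rv M (count_space UNIV) G T X"
    and K: "finite K" "\<And>\<omega>. \<omega> \<in> space M \<Longrightarrow> G \<omega> \<in> K"
    and D: "\<And>g. g \<in> K \<Longrightarrow> {x \<in> space T. Q g x} \<in> sets T"
  shows "prob {\<omega> \<in> space M. Q (G \<omega>) (X \<omega>)} =
    (\<Sum>g\<in>K. prob {\<omega> \<in> space M. G \<omega> = g} * measure (distr M T X) {x \<in> space T. Q g x})"
proof -
  have [measurable]: "G \<in> measurable M (count_space UNIV)" "X \<in> measurable M T"
    and set: "indep_set (sigma_sets (space M) {G -` A \<inter> space M | A. A \<in> sets (count_space UNIV)})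
       (sigma_sets (space M) {X -` A \<inter> space M | A. A \<in> sets T})"
    using indep by (auto simp: indep_rv_def)
  let ?E = "\<lambda>g. G -` {g} \<inter> space M \<inter> (X -` {x \<in> space T. Q g x} \<inter> space M)"
  have "{\<omega> \<in> space M. Q (G \<omega>) (X \<omega>)} = (\<Union>g\<in>K. ?E g)"
    using K(2) measurable_space[OF \<open>X \<in> measurable M T\<close>] by auto
  also have "prob \<dots> = (\<Sum>g\<in>K. prob (?E g))"
    using K(1) D by (intro finite_measure_finite_Union) (auto simp: disjoint_family_on_def)
  also have "\<dots> = (\<Sum>g\<in>K. prob {\<omega> \<in> space M. G \<omega> = g} * measure (distr M T X) {x \<in> space T. Q g x})"
  proof (rule sum.cong[OF refl])
    fix g assume "g \<in> K"
    have "prob (?E g) = prob (G -` {g} \<inter> space M) * prob (X -` {x \<in> space T. Q g x} \<inter> space M)"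
      using D[OF \<open>g \<in> K\<close>] by (intro indep_setD[OF set] sigma_sets.Basic CollectI exI conjI refl) auto
    moreover have "G -` {g} \<inter> space M = {\<omega> \<in> space M. G \<omega> = g}" by auto
    ultimately show "prob (?E g) =
        prob {\<omega> \<in> space M. G \<omega> = g} * measure (distr M T X) {x \<in> space T. Q g x}"
      using measure_distr[OF \<open>X \<in> measurable M T\<close> D[OF \<open>g \<in> K\<close>]] by simp
  qed
  finally show ?thesis .
qed

section \<open>Estimates from the batches of a fixed split\<close>

text \<open>Relabelling the coordinates along \<open>I\<close> carries measurability from initial
  segments over to arbitrary batches.\<close>

lemma measurable_batch:
  fixes A :: "'w list \<Rightarrow> real"
  assumes meas: "\<And>m. (\<lambda>w. A (map w [0..<m])) \<in> borel_measurable (\<Pi>\<^sub>M i\<in>{..<m}. S)"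
    and I: "set I \<subseteq> K"
  shows "(\<lambda>x. A (map x I)) \<in> borel_measurable (\<Pi>\<^sub>M i\<in>K. S)"
proof -
  let ?m = "length I"
  have "(\<lambda>x. \<lambda>n\<in>{..<?m}. x (I ! n)) \<in> measurable (\<Pi>\<^sub>M i\<in>K. S) (\<Pi>\<^sub>M i\<in>{..<?m}. S)"
    using I by (intro measurable_restrict measurable_component_singleton) auto
  from measurable_compose[OF this meas[of ?m]]
  have "(\<lambda>x. A (map (\<lambda>n\<in>{..<?m}. x (I ! n)) [0..<?m])) \<in> borel_measurable (\<Pi>\<^sub>M i\<in>K. S)" .
  moreover have "map (\<lambda>n\<in>{..<?m}. x (I ! n)) [0..<?m] = map x I" for x :: "_ \<Rightarrow> 'w"
    by (rule nth_equalityI) auto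
  ultimately show ?thesis by simp
qed

text \<open>Distinct coordinates of an i.i.d. sample are again an i.i.d. sample, so the law of an
  estimate depends on its batch only through the size.\<close>

lemma measure_batch:
  fixes A :: "'w list \<Rightarrow> real"
  assumes "prob_space P"
    and meas: "\<And>m. (\<lambda>w. A (map w [0..<m])) \<in> borel_measurable (\<Pi>\<^sub>M i\<in>{..<m}. P)"
    and I: "set I \<subseteq> K" "distinct I"
  shows "measure (\<Pi>\<^sub>M i\<in>K. P) {x \<in> space (\<Pi>\<^sub>M i\<in>K. P). A (map x I) \<le> y} =
    measure (\<Pi>\<^sub>M i\<in>{..<length I}. P)
      {w \<in> space (\<Pi>\<^sub>M i\<in>{..<length I}. P). A (map w [0..<length I]) \<le> y}"
proof -
  let ?m = "length I"
  let ?f = "\<lambda>x. \<lambda>n\<in>{..<?m}. x (I ! n)"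
  let ?PK = "\<Pi>\<^sub>M i\<in>K. P" and ?Pm = "\<Pi>\<^sub>M i\<in>{..<?m}. P"
  let ?E = "{w \<in> space ?Pm. A (map w [0..<?m]) \<le> y}"
  have f: "?f \<in> measurable ?PK ?Pm"
    using I by (intro measurable_restrict measurable_component_singleton) auto
  have "distr ?PK ?Pm ?f = ?Pm"
    using assms by (intro distr_PiM_reindex) (auto simp: inj_on_def nth_eq_iff_index_eq)
  then have "measure ?Pm ?E = measure (distr ?PK ?Pm ?f) ?E" by simp
  also have "?E \<in> sets ?Pm"
    using meas[of ?m] by measurable
  then have "measure (distr ?PK ?Pm ?f) ?E = measure ?PK (?f -` ?E \<inter> space ?PK)"
    using f by (intro measure_distr) auto
  also have "?f -` ?E \<inter> space ?PK = {x \<in> space ?PK. A (map x I) \<le> y}"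
  proof -
    have "map (?f x) [0..<?m] = map x I" for x :: "_ \<Rightarrow> 'w"
      by (rule nth_equalityI) auto
    then show ?thesis using measurable_space[OF f] by auto
  qed
  finally show ?thesis by simp
qed

text \<open>The joint law of the coordinates is the product of their marginals. This
  characterisation of independence requires a nonempty index set, hence the case
  distinction.\<close>

lemma indep_vars_PiM_components:
  assumes "prob_space P"
  shows "prob_space.indep_vars (\<Pi>\<^sub>M i\<in>K. P) (\<lambda>_. P) (\<lambda>i x. x i) K"
proof (cases "K = {}")
  case True
  interpret prob_space "\<Pi>\<^sub>M i\<in>K. P"
    using assms by (intro prob_space_PiM)
  show ?thesis unfolding indep_vars_def indep_sets_def by (simp add: True)
next
  case False
  interpret prob_space "\<Pi>\<^sub>M i\<in>K. P"
    using assms by (intro prob_space_PiM)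
  have "distr (\<Pi>\<^sub>M i\<in>K. P) (\<Pi>\<^sub>M i\<in>K. P) (\<lambda>x. \<lambda>i\<in>K. x i) =
      distr (\<Pi>\<^sub>M i\<in>K. P) (\<Pi>\<^sub>M i\<in>K. P) (\<lambda>x. x)"
    by (intro distr_cong) (auto simp: space_PiM PiE_restrict)
  also have "\<dots> = (\<Pi>\<^sub>M i\<in>K. P)" by simp
  also have "\<dots> = (\<Pi>\<^sub>M i\<in>K. distr (\<Pi>\<^sub>M i\<in>K. P) P (\<lambda>x. x i))"
    using assms by (intro PiM_cong refl distr_PiM_component[symmetric]) auto
  finally show ?thesis
    using False by (subst indep_vars_iff_distr_eq_PiM') auto
qed

text \<open>The estimates are functions of disjoint groups of independent coordinates.\<close>

lemma indep_vars_batches: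
  fixes A :: "'w list \<Rightarrow> real"
  assumes "prob_space P"
    and meas: "\<And>m. (\<lambda>w. A (map w [0..<m])) \<in> borel_measurable (\<Pi>\<^sub>M i\<in>{..<m}. P)"
    and g: "g \<in> splits N B"
  shows "prob_space.indep_vars (\<Pi>\<^sub>M i\<in>{..<N}. P) (\<lambda>_. borel) (\<lambda>j x. A (map x (g ! j))) {..<B}"
proof -
  interpret prob_space "\<Pi>\<^sub>M i\<in>{..<N}. P"
    using assms by (intro prob_space_PiM)
  have "indep_vars (\<lambda>j. \<Pi>\<^sub>M i\<in>set (g ! j). P) (\<lambda>j x. \<lambda>i\<in>set (g ! j). x i) {..<B}"
    using splitsD[OF g]
    by (intro indep_vars_restrict[OF indep_vars_PiM_components] assms splits_disjoint[OF g]) auto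
  then have "indep_vars (\<lambda>_. borel) (\<lambda>j x. A (map (\<lambda>i\<in>set (g ! j). x i) (g ! j))) {..<B}"
    by (rule indep_vars_compose2[where Y = "\<lambda>j x. A (map x (g ! j))"])
       (rule measurable_batch[OF meas subset_refl])
  then show ?thesis
    by (simp cong: map_cong)
qed

section \<open>The width bound\<close>

theorem theorem6:
  fixes M :: "'a measure" and S P :: "'w measure"
    and W :: "nat \<Rightarrow> 'a \<Rightarrow> 'w" and G :: "'a \<Rightarrow> nat list list" and U :: "'a \<Rightarrow> real"
    and A :: "'w list \<Rightarrow> real" and N B :: nat
    and \<theta>\<^sub>0 \<alpha> \<delta> \<rho> C \<Delta> E :: real and r F :: "real \<Rightarrow> real"
  assumes "prob_space M"
    and "0 < \<alpha>" "\<alpha> < 1" and "0 < N" and "real B \<ge> log 2 (2 / \<alpha>)"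
    and data_indep: "prob_space.indep_vars M (\<lambda>_. S) W {..<N}"
    and data_ident: "\<And>i. i < N \<Longrightarrow> distr M S (W i) = P"
    and procedure_meas:
      "\<And>m. (\<lambda>w. A (map w [0..<m])) \<in> borel_measurable (\<Pi>\<^sub>M i\<in>{..<m}. S)"
    and split: "\<And>\<omega>. \<omega> \<in> space M \<Longrightarrow> G \<omega> \<in> splits N B"
    and split_indep: "indep_rv M
      (count_space UNIV) G (\<Pi>\<^sub>M i\<in>{..<N}. S) (\<lambda>\<omega>. \<lambda>i\<in>{..<N}. W i \<omega>)"
    and U_unif: "distr M borel U = uniform_measure lborel {0<..<1}"
    and U_indep: "indep_rv M
      borel U (\<Pi>\<^sub>M i\<in>{..<N}. S) (\<lambda>\<omega>. \<lambda>i\<in>{..<N}. W i \<omega>)"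
    and rate_pos: "\<And>m. m > 0 \<Longrightarrow> r m > 0"
    and rate: "bounded_in_prob (\<lambda>m. \<Pi>\<^sub>M i\<in>{..<m}. P)
      (\<lambda>m w. r (real m) * (A (map w [0..<m]) - \<theta>\<^sub>0))"
    and common_cdf: "\<And>j. j < B \<Longrightarrow>
      cdf (distr M borel (\<lambda>\<omega>. r (real N / real B) *
        (batch_estimates A (\<lambda>i. W i \<omega>) (G \<omega>) ! j - \<theta>\<^sub>0))) = F"
    and "\<rho> > 0" "C > 0" "\<Delta> > 0"
    and growth: "\<And>x. 0 < \<bar>x\<bar> \<Longrightarrow> \<bar>x\<bar> < \<Delta> \<Longrightarrow> \<bar>F x - F 0\<bar> > C * \<bar>x\<bar> powr \<rho>"
    and "E \<ge> 0" and median_bias: "\<bar>F 0 - 1 / 2\<bar> \<le> E"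
    and "0 < \<delta>" "\<delta> < 1"
    and B_large: "2 / (C powr (1 / \<rho>) * r (real N / real B)) *
        ((5 * ln (2 / \<delta>) + sqrt (2 * ln (2 / \<alpha>))) / (2 * sqrt (real B)) + 2 / real B + E)
          powr (1 / \<rho>)
      < 2 * \<Delta> / r (real N / real B)"
  shows "measure M {\<omega> \<in> space M.
      width (ghulc_CI \<alpha> (U \<omega>) (batch_estimates A (\<lambda>i. W i \<omega>) (G \<omega>)))
        \<le> 2 / (C powr (1 / \<rho>) * r (real N / real B)) *
          ((5 * ln (2 / \<delta>) + sqrt (2 * ln (2 / \<alpha>))) / (2 * sqrt (real B)) + 2 / real B + E)
            powr (1 / \<rho>)}
    \<ge> 1 - \<delta>"
proof -
  interpret prob_space M by fact
  define R where "R = r (real N / real B)"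
  define T where "T = (\<Pi>\<^sub>M i\<in>{..<N}. S)"
  define D where "D = (\<Pi>\<^sub>M i\<in>{..<N}. P)"
  define X where "X = (\<lambda>\<omega>. \<lambda>i\<in>{..<N}. W i \<omega>)"
  define \<theta> where "\<theta> = (\<lambda>\<omega>. batch_estimates A (\<lambda>i. W i \<omega>) (G \<omega>))"
  define p where "p = (\<lambda>g. prob {\<omega> \<in> space M. G \<omega> = g})"

  \<comment> \<open>This rules out \<open>B = 0\<close>, so that dividing by \<open>B\<close> is
    legitimate.\<close>
  have "1 < log 2 (2 / \<alpha>)"
    using assms(2,3) by (subst less_log_iff) (auto simp: field_simps)
  then have B: "B > 0"
    using assms(5) by (cases B) auto
  then have R: "R > 0"
    unfolding R_def using assms(4) by (intro rate_pos) auto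

  have W: "W i \<in> measurable M S" if "i < N" for i
    using data_indep that by (auto simp: indep_vars_def)
  have P: "prob_space P" and sets_P: "sets P = sets S"
    using prob_space_distr[OF W[OF assms(4)]] data_ident[OF assms(4), symmetric] by simp_all
  interpret D: prob_space D
    unfolding D_def using P by (intro prob_space_PiM)
  \<comment> \<open>\<open>T\<close> and \<open>D\<close> carry the same sigma-algebra;
    \<open>D\<close> will turn out to be the law of the data \<open>X\<close>.\<close>
  have space_T: "space T = space D" and sets_T: "sets T = sets D"
    unfolding T_def D_def using sets_P sets_eq_imp_space_eq[OF sets_P]
    by (auto intro!: PiM_cong sets_PiM_cong simp: space_PiM)
  have X: "X \<in> measurable M T"
    unfolding X_def T_def using W by (intro measurable_restrict) auto
  have "distr M T X = (\<Pi>\<^sub>M i\<in>{..<N}. distr M S (W i))"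
    unfolding T_def X_def using data_indep W assms(4)
    by (subst indep_vars_iff_distr_eq_PiM'[symmetric]) auto
  also have "\<dots> = D"
    unfolding D_def using data_ident by (intro PiM_cong) auto
  finally have distr_X: "distr M T X = D" .
  have G_indep: "indep_rv M (count_space UNIV) G T X"
    using split_indep unfolding T_def X_def .
  then have G[measurable]: "G \<in> measurable M (count_space UNIV)"
    by (simp add: indep_rv_def)

  have meas_P: "(\<lambda>w. A (map w [0..<m])) \<in> borel_measurable (\<Pi>\<^sub>M i\<in>{..<m}. P)" for m
    using procedure_meas[of m] sets_P by (simp cong: measurable_cong_sets sets_PiM_cong)
  have batch_D[measurable]: "(\<lambda>x. A (map x (g ! j))) \<in> borel_measurable D"
    if "g \<in> splits N B" "j < B" for g j
    unfolding D_def using splitsD(3)[OF that] by (rule measurable_batch[OF meas_P])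
  \<comment> \<open>Every event about split and data becomes a weighted average over fixed splits,
    with the data distributed as \<open>D\<close>.\<close>
  have mixture: "prob {\<omega> \<in> space M. Q (G \<omega>) (X \<omega>)} =
      (\<Sum>g\<in>splits N B. p g * measure D {x \<in> space D. Q g x})"
    if "\<And>g. g \<in> splits N B \<Longrightarrow> {x \<in> space D. Q g x} \<in> sets D" for Q
    using prob_indep_rv_mixture[OF G_indep finite_splits split, where Q = Q] that
    by (simp add: distr_X space_T sets_T p_def)
  have sum_p: "(\<Sum>g\<in>splits N B. p g) = 1"
    using mixture[of "\<lambda>_ _. True"] by (simp add: prob_space D.prob_space)

  have length_\<theta>: "length (\<theta> \<omega>) = B" if "\<omega> \<in> space M" for \<omega>
    using split[OF that] by (simp add: \<theta>_def batch_estimates_def splits_def)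
  \<comment> \<open>Batches contain only indices below \<open>N\<close>, where the restricted
    function \<open>X \<omega>\<close> agrees with the data.\<close>
  have \<theta>_nth: "\<theta> \<omega> ! j = A (map (X \<omega>) (G \<omega> ! j))" if "\<omega> \<in> space M" "j < B" for \<omega> j
  proof -
    have "map (\<lambda>i. W i \<omega>) (G \<omega> ! j) = map (X \<omega>) (G \<omega> ! j)"
      using splitsD(3)[OF split[OF that(1)] that(2)] by (auto simp: X_def)
    then show ?thesis
      using splitsD(1)[OF split[OF that(1)] that(2)] that(2)
      by (simp add: \<theta>_def batch_estimates_def del: map_eq_conv)
  qed
  have \<theta>_meas[measurable]: "(\<lambda>\<omega>. \<theta> \<omega> ! j) \<in> borel_measurable M" if "j < B" for j
  proof -
    \<comment> \<open>Composition with the countably valued \<open>G\<close> requires measurability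
      for every list \<open>g\<close>, hence the default 0 for lists that are not splits. On
      \<open>space M\<close> the guard always holds.\<close>
    have "(\<lambda>\<omega>. if g \<in> splits N B then A (map (X \<omega>) (g ! j)) else 0) \<in> borel_measurable M" for g
    proof (cases "g \<in> splits N B")
      case True
      then have "(\<lambda>x. A (map x (g ! j))) \<in> borel_measurable T"
        using batch_D[OF True that] by (simp add: sets_T cong: measurable_cong_sets)
      from measurable_compose[OF X this] True show ?thesis by simp
    qed simp
    from measurable_compose_countable[OF this G]
    have "(\<lambda>\<omega>. if G \<omega> \<in> splits N B then A (map (X \<omega>) (G \<omega> ! j)) else 0) \<in> borel_measurable M" .
    then show ?thesis
      by (rule measurable_cong[THEN iffD1, rotated]) (simp add: split \<theta>_nth[OF _ that])
  qed

  have F_eq: "F z = prob {\<omega> \<in> space M. \<theta> \<omega> ! j \<le> \<theta>\<^sub>0 + z / R}" if "j < B" for j z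
  proof -
    have [measurable]: "(\<lambda>\<omega>. \<theta> \<omega> ! j) \<in> borel_measurable M" using that by (rule \<theta>_meas)
    have "F z = cdf (distr M borel (\<lambda>\<omega>. R * (\<theta> \<omega> ! j - \<theta>\<^sub>0))) z"
      using common_cdf[OF that] by (simp add: R_def \<theta>_def)
    also have "\<dots> = prob ((\<lambda>\<omega>. R * (\<theta> \<omega> ! j - \<theta>\<^sub>0)) -` {..z} \<inter> space M)"
      unfolding cdf_def by (intro measure_distr) auto
    also have "(\<lambda>\<omega>. R * (\<theta> \<omega> ! j - \<theta>\<^sub>0)) -` {..z} \<inter> space M =
        {\<omega> \<in> space M. \<theta> \<omega> ! j \<le> \<theta>\<^sub>0 + z / R}"
      using R by (auto simp: field_simps)
    finally show ?thesis .
  qed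
  have F_mono: "F x \<le> F y" if "x \<le> y" for x y
    unfolding F_eq[OF B] using R that \<theta>_meas[OF B]
    by (intro finite_measure_mono) (auto intro: order_trans simp: divide_right_mono)
  have F_01: "0 \<le> F x" "F x \<le> 1" for x
    unfolding F_eq[OF B] by auto

  \<comment> \<open>The expected count given the split\<close>
  have mean_count: "(\<Sum>j<B. measure D {x \<in> space D. A (map x (g ! j)) \<le> \<theta>\<^sub>0 + z / R}) = real B * F z"
    if g: "g \<in> splits N B" for g z
  proof -
    define H where "H = (\<lambda>g j. measure D {x \<in> space D. A (map x (g ! j)) \<le> \<theta>\<^sub>0 + z / R})"
    define h where "h = (\<lambda>m. measure (\<Pi>\<^sub>M i\<in>{..<m}. P)
      {w \<in> space (\<Pi>\<^sub>M i\<in>{..<m}. P). A (map w [0..<m]) \<le> \<theta>\<^sub>0 + z / R})"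
    have "H g' j = h (length (g' ! j))" if "g' \<in> splits N B" "j < B" for g' j
      unfolding H_def h_def D_def using splitsD[OF that] by (intro measure_batch P meas_P)
    then have same: "(\<Sum>j<B. H g' j) = (\<Sum>j<B. H g j)" if "g' \<in> splits N B" for g'
      using sum_splits[OF that, of h] sum_splits[OF g, of h] that g by simp
    have Fz: "F z = (\<Sum>g\<in>splits N B. p g * H g j)" if "j < B" for j
    proof -
      have "F z = prob {\<omega> \<in> space M. A (map (X \<omega>) (G \<omega> ! j)) \<le> \<theta>\<^sub>0 + z / R}"
        unfolding F_eq[OF that] using \<theta>_nth[OF _ that] by (metis (mono_tags, lifting))
      also have "\<dots> = (\<Sum>g\<in>splits N B. p g * H g j)"
        unfolding H_def
      proof (rule mixture)
        fix g assume "g \<in> splits N B"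
        note [measurable] = batch_D[OF this that]
        show "{x \<in> space D. A (map x (g ! j)) \<le> \<theta>\<^sub>0 + z / R} \<in> sets D" by measurable
      qed
      finally show ?thesis .
    qed
    \<comment> \<open>\<open>F z\<close> is the average over splits for each \<open>j\<close>. After
      summing over \<open>j\<close> and swapping the sums, the inner sum no longer depends on the
      split, and the weights \<open>p g\<close> add up to 1.\<close>
    have "real B * F z = (\<Sum>j<B. F z)" by simp
    also have "\<dots> = (\<Sum>j<B. \<Sum>g\<in>splits N B. p g * H g j)"
      using Fz by (intro sum.cong) auto
    also have "\<dots> = (\<Sum>g\<in>splits N B. p g * (\<Sum>j<B. H g j))"
      by (subst sum.swap) (simp add: sum_distrib_left)
    also have "\<dots> = (\<Sum>g'\<in>splits N B. p g' * (\<Sum>j<B. H g j))"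
      using same by (intro sum.cong) auto
    also have "\<dots> = (\<Sum>j<B. H g j)"
      using sum_p by (simp flip: sum_distrib_right)
    finally show ?thesis by (simp add: H_def)
  qed

  \<comment> \<open>Choice of the constants and the growth condition\<close>
  define L where "L = ln (2 / \<delta>)"
  define s where "s = sqrt (real B * ln (2 / \<alpha>) / 2)"
  \<comment> \<open>After multiplication by \<open>B\<close>, the braces without \<open>E\<close>
    become \<open>e + s + 2\<close>: \<open>e\<close> is the deviation allowed in Hoeffding's
    inequality, \<open>s\<close> bounds \<open>ghulc_c\<close>, and 2 pays for rounding and for the
    unit in the upper index.\<close>
  define e where "e = 5 * L * sqrt (real B) / 2"
  define \<eta> where "\<eta> = (5 * L + sqrt (2 * ln (2 / \<alpha>))) / (2 * sqrt (real B)) + 2 / real B + E"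
  define t where "t = (\<eta> / C) powr (1 / \<rho>)"
  \<comment> \<open>A lower bound on \<open>L\<close> is wanted so that the quadratic exponent in
    Hoeffding's inequality dominates \<open>L\<close>.\<close>
  have "ln (\<delta> / 2) \<le> \<delta> / 2 - 1"
    using \<open>0 < \<delta>\<close> by (intro ln_le_minus_one) simp
  then have L: "L \<ge> 1 / 2"
    using \<open>0 < \<delta>\<close> \<open>\<delta> < 1\<close> by (simp add: L_def ln_div)
  have "ln (2 / \<alpha>) > 0"
    using assms(2,3) by simp
  then have "s \<ge> 0" "e \<ge> 0"
    using L by (simp_all add: s_def e_def)
  have "s = sqrt (real B * (2 * ln (2 / \<alpha>)) / 4)"
    by (simp add: s_def)
  also have "\<dots> = sqrt (real B) * sqrt (2 * ln (2 / \<alpha>)) / 2"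
    by (simp only: real_sqrt_divide real_sqrt_mult real_sqrt_four)
  finally have s_eq: "s = sqrt (real B) * sqrt (2 * ln (2 / \<alpha>)) / 2" .
  have scale: "real B * (x / (2 * sqrt (real B))) = sqrt (real B) * x / 2" for x
  proof -
    have "q * q * (x / (2 * q)) = q * x / 2" if "q \<noteq> 0" for q :: real
      using that by simp
    from this[of "sqrt (real B)"] B show ?thesis by simp
  qed
  have "real B * (\<eta> - E) =
      sqrt (real B) * (5 * L + sqrt (2 * ln (2 / \<alpha>))) / 2 + 2"
    unfolding \<eta>_def add_diff_cancel_right' distrib_left[of "real B"] scale using B by simp
  also have "\<dots> = e + s + 2"
    by (simp add: e_def s_eq algebra_simps add_divide_distrib)
  finally have B\<eta>: "real B * (\<eta> - E) = e + s + 2" .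
  then have "real B * (\<eta> - E) > 0"
    using \<open>s \<ge> 0\<close> \<open>e \<ge> 0\<close> by simp
  then have "\<eta> > E"
    by (simp add: zero_less_mult_iff)
  then have "\<eta> > 0"
    using \<open>E \<ge> 0\<close> by simp
  have "t > 0"
    using \<open>\<eta> > 0\<close> \<open>C > 0\<close> by (simp add: t_def)
  have Ct: "C * t powr \<rho> = \<eta>"
    using \<open>\<eta> > 0\<close> \<open>C > 0\<close> \<open>\<rho> > 0\<close> by (simp add: t_def powr_powr)
  have bound_eq: "2 / (C powr (1 / \<rho>) * R) * \<eta> powr (1 / \<rho>) = 2 * t / R"
    using \<open>\<eta> > 0\<close> \<open>C > 0\<close> by (simp add: t_def powr_divide)
  \<comment> \<open>The size condition on \<open>B\<close> says exactly that
    \<open>t < \<Delta>\<close>, so the growth condition applies at \<open>t\<close> and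
    \<open>- t\<close>.\<close>
  have "2 * t / R < 2 * \<Delta> / R"
    using B_large unfolding R_def[symmetric] L_def[symmetric] \<eta>_def[symmetric] bound_eq .
  then have "t < \<Delta>"
    using R by (simp add: divide_less_cancel)
  \<comment> \<open>Growth controls only an absolute difference; monotonicity of \<open>F\<close>
    supplies its sign, and the median bias costs at most \<open>E\<close>.\<close>
  have "F t > 1 / 2 + (\<eta> - E)"
    using growth[of t] F_mono[of 0 t] median_bias \<open>t > 0\<close> \<open>t < \<Delta>\<close> Ct by auto
  then have "real B * F t > real B * (1 / 2 + (\<eta> - E))"
    using B by simp
  then have up: "real B * F t > real B / 2 + e + s + 2"
    using B\<eta> by (simp add: distrib_left)
  have "F (- t) < 1 / 2 - (\<eta> - E)"
    using growth[of "- t"] F_mono[of "- t" 0] median_bias \<open>t > 0\<close> \<open>t < \<Delta>\<close> Ct by auto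
  then have "real B * F (- t) < real B * (1 / 2 - (\<eta> - E))"
    using B by simp
  then have down: "real B * F (- t) < real B / 2 - e - s - 2"
    using B\<eta> by (simp add: right_diff_distrib)

  \<comment> \<open>Comparing the indices with the expected counts\<close>
  define c where "c = ghulc_c B \<alpha>"
  define lo where "lo = \<lfloor>real B / 2\<rfloor> - c"
  define hi where "hi = \<lceil>real B / 2\<rceil> + c + 1"
  have c: "real_of_int c \<le> s"
    unfolding c_def s_def by (rule ghulc_c_le[OF B assms(2,3)])
  then have hi: "real_of_int hi < real B * F t - e"
    using up by (simp add: hi_def) linarith
  \<comment> \<open>Since \<open>F\<close> takes values in [0, 1], the same comparisons force both
    indices into the range from 1 to \<open>B\<close>.\<close>
  have "real B * F t \<le> real B" using F_01(2)[of t] B by simp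
  with hi \<open>e \<ge> 0\<close> have hi_le: "hi \<le> int B" by linarith
  have lo: "real_of_int lo > real B * F (- t) + e"
    using c down by (simp add: lo_def) linarith
  have "real B * F (- t) \<ge> 0" using F_01(1)[of "- t"] by simp
  with lo \<open>e \<ge> 0\<close> have lo_ge: "1 \<le> lo" by linarith

  \<comment> \<open>The good event for a fixed split\<close>
  \<comment> \<open>Written with \<open>(- t) / R\<close> to match \<open>mean_count\<close> at
    \<open>z = - t\<close>.\<close>
  define a where "a = \<theta>\<^sub>0 + (- t) / R"
  define b where "b = \<theta>\<^sub>0 + t / R"
  define good where "good = (\<lambda>(g :: nat list list) x. int (card {j. j < B \<and> A (map x (g ! j)) \<le> a}) < lo \<and>
    int (card {j. j < B \<and> A (map x (g ! j)) \<le> b}) \<ge> hi)"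
  have count_meas: "(\<lambda>x. real (card {j. j < B \<and> A (map x (g ! j)) \<le> y})) \<in> borel_measurable D"
    if "g \<in> splits N B" for g y
  proof -
    note [measurable] = batch_D[OF that]
    have "real (card {j. j < B \<and> A (map x (g ! j)) \<le> y}) =
        (\<Sum>j<B. if A (map x (g ! j)) \<le> y then 1 else 0)" for x
      by (simp add: sum.If_cases Int_def)
    then show ?thesis by simp
  qed
  \<comment> \<open>The exponent equals \<open>25 / 2 * L * L\<close>, which is at least
    \<open>L\<close> because \<open>L \<ge> 1 / 2\<close>; each tail thus gets half of
    \<open>\<delta>\<close>.\<close>
  have "exp (- 2 * e\<^sup>2 / real B) \<le> exp (- L)"
  proof -
    have "2 * e\<^sup>2 / real B = 25 / 2 * L * L"
      using B by (simp add: e_def power2_eq_square field_simps)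
    moreover have "1 * L \<le> 25 / 2 * L * L"
      using L by (intro mult_right_mono) auto
    ultimately show ?thesis by simp
  qed
  also have "exp (- L) = \<delta> / 2"
    using \<open>0 < \<delta>\<close> by (simp add: L_def exp_minus)
  finally have tail: "exp (- 2 * e\<^sup>2 / real B) \<le> \<delta> / 2" .
  have good_D: "{x \<in> space D. good g x} \<in> sets D \<and> measure D {x \<in> space D. good g x} \<ge> 1 - \<delta>"
    if g: "g \<in> splits N B" for g
  proof -
    let ?n = "\<lambda>y x. real (card {j. j < B \<and> A (map x (g ! j)) \<le> y})"
    note [measurable] = count_meas[OF g]
    have ind: "D.indep_vars (\<lambda>_. borel) (\<lambda>j x. A (map x (g ! j))) {..<B}"
      unfolding D_def by (rule indep_vars_batches[OF P meas_P g])
    have "measure D {x \<in> space D. ?n b x \<le> real B * F t - e} \<le> \<delta> / 2"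
      using D.Hoeffding_count(1)[OF ind _ _ \<open>e \<ge> 0\<close>, of b] B mean_count[OF g, of t] tail
      by (simp add: b_def lessThan_empty_iff)
    moreover have "measure D {x \<in> space D. ?n a x \<ge> real B * F (- t) + e} \<le> \<delta> / 2"
      using D.Hoeffding_count(2)[OF ind _ _ \<open>e \<ge> 0\<close>, of a] B mean_count[OF g, of "- t"] tail
      by (simp add: a_def lessThan_empty_iff)
    moreover have "measure D ({x \<in> space D. ?n b x \<le> real B * F t - e} \<union>
        {x \<in> space D. ?n a x \<ge> real B * F (- t) + e}) \<le>
        measure D {x \<in> space D. ?n b x \<le> real B * F t - e} +
        measure D {x \<in> space D. ?n a x \<ge> real B * F (- t) + e}"
      by (rule measure_Un_le) measurable
    ultimately have "measure D ({x \<in> space D. ?n b x \<le> real B * F t - e} \<union>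
        {x \<in> space D. ?n a x \<ge> real B * F (- t) + e}) \<le> \<delta>"
      by linarith
    moreover have good_eq: "{x \<in> space D. good g x} =
        {x \<in> space D. ?n a x < real_of_int lo \<and> ?n b x \<ge> real_of_int hi}"
      unfolding good_def by (intro Collect_cong conj_cong refl) linarith+
    then have meas: "{x \<in> space D. good g x} \<in> sets D" by simp
    \<comment> \<open>If the good event fails, one of the counts passes \<open>lo\<close> or
      \<open>hi\<close> on the wrong side and therefore deviates from its mean by at least
      \<open>e\<close>.\<close>
    moreover have "measure D (space D - {x \<in> space D. good g x}) \<le>
        measure D ({x \<in> space D. ?n b x \<le> real B * F t - e} \<union>
        {x \<in> space D. ?n a x \<ge> real B * F (- t) + e})"
      using lo hi by (intro D.finite_measure_mono) (auto simp: good_eq)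
    ultimately show ?thesis
      using D.prob_compl[OF meas] by simp
  qed

  \<comment> \<open>Averaging over the split\<close>
  have "1 - \<delta> = (\<Sum>g\<in>splits N B. p g * (1 - \<delta>))"
    using sum_p by (simp flip: sum_distrib_right)
  also have "\<dots> \<le> (\<Sum>g\<in>splits N B. p g * measure D {x \<in> space D. good g x})"
    using good_D by (intro sum_mono mult_left_mono) (auto simp: p_def)
  also have "\<dots> = prob {\<omega> \<in> space M. good (G \<omega>) (X \<omega>)}"
    using good_D by (intro mixture[symmetric]) auto
  also have "\<dots> \<le> prob {\<omega> \<in> space M. width (ghulc_CI \<alpha> (U \<omega>) (\<theta> \<omega>)) \<le> 2 * t / R}"
  proof (rule finite_measure_mono)
    show "{\<omega> \<in> space M. good (G \<omega>) (X \<omega>)} \<subseteq>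
        {\<omega> \<in> space M. width (ghulc_CI \<alpha> (U \<omega>) (\<theta> \<omega>)) \<le> 2 * t / R}"
    proof (intro subsetI CollectI conjI; elim CollectE conjE)
      fix \<omega> assume \<omega>: "\<omega> \<in> space M" and good: "good (G \<omega>) (X \<omega>)"
      have count: "{j. j < B \<and> \<theta> \<omega> ! j \<le> y} = {j. j < B \<and> A (map (X \<omega>) (G \<omega> ! j)) \<le> y}" for y
        using \<theta>_nth[OF \<omega>] by auto
      have "a \<le> b"
        using \<open>t > 0\<close> R by (simp add: a_def b_def)
      then have "width (ghulc_CI \<alpha> (U \<omega>) (\<theta> \<omega>)) \<le> b - a"
        using good lo_ge hi_le unfolding good_def lo_def hi_def c_def count[symmetric]
        by (intro width_ghulc_CI_le) (simp_all add: length_\<theta>[OF \<omega>])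
      then show "width (ghulc_CI \<alpha> (U \<omega>) (\<theta> \<omega>)) \<le> 2 * t / R"
        by (simp add: a_def b_def)
    qed
    \<comment> \<open>Monotonicity of the measure needs the width event to be measurable.
      \<open>V\<close> is the width for a deterministic \<open>c\<close>; the randomised width
      switches between two such functions according to \<open>U\<close>.\<close>
    define V where "V = (\<lambda>c \<omega>. if \<lfloor>real B / 2\<rfloor> - c \<le> \<lceil>real B / 2\<rceil> + c + 1
      then order_stat (\<theta> \<omega>) (\<lceil>real B / 2\<rceil> + c + 1) - order_stat (\<theta> \<omega>) (\<lfloor>real B / 2\<rfloor> - c) else 0)"
    \<comment> \<open>For \<open>c' \<le> c\<close> the indices lie inside the range from
      \<open>lo\<close> to \<open>hi\<close> unless they cross, in which case \<open>V\<close> is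
      constantly 0.\<close>
    have V: "V c' \<in> borel_measurable M" if "c' \<le> c" for c'
    proof (cases "\<lfloor>real B / 2\<rfloor> - c' \<le> \<lceil>real B / 2\<rceil> + c' + 1")
      case True
      then have "(\<lambda>\<omega>. order_stat (\<theta> \<omega>) (\<lceil>real B / 2\<rceil> + c' + 1)) \<in> borel_measurable M"
        "(\<lambda>\<omega>. order_stat (\<theta> \<omega>) (\<lfloor>real B / 2\<rfloor> - c')) \<in> borel_measurable M"
        using that lo_ge hi_le unfolding lo_def hi_def
        by (auto intro!: borel_measurable_order_stat[OF \<theta>_meas length_\<theta>])
      with True show ?thesis unfolding V_def by simp
    qed (simp add: V_def)
    have [measurable]: "U \<in> borel_measurable M"
      using U_indep by (simp add: indep_rv_def)
    have "width (ghulc_CI \<alpha> (U \<omega>) (\<theta> \<omega>)) = (if U \<omega> \<le> ghulc_tau B \<alpha> then V (c - 1) \<omega> else V c \<omega>)"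
      if "\<omega> \<in> space M" for \<omega>
      using lo_ge hi_le length_\<theta>[OF that] ghulc_cstar_le[of B \<alpha> "U \<omega>"] unfolding lo_def hi_def c_def
      by (subst width_ghulc_CI) (auto simp: V_def ghulc_cstar_def)
    moreover have "(\<lambda>\<omega>. if U \<omega> \<le> ghulc_tau B \<alpha> then V (c - 1) \<omega> else V c \<omega>) \<in> borel_measurable M"
      using V[of "c - 1"] V[of c] by simp
    ultimately have [measurable]: "(\<lambda>\<omega>. width (ghulc_CI \<alpha> (U \<omega>) (\<theta> \<omega>))) \<in> borel_measurable M"
      by (simp cong: measurable_cong)
    show "{\<omega> \<in> space M. width (ghulc_CI \<alpha> (U \<omega>) (\<theta> \<omega>)) \<le> 2 * t / R} \<in> sets M"
      by measurable
  qed
  finally show ?thesis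
    unfolding R_def[symmetric] L_def[symmetric] \<eta>_def[symmetric] bound_eq \<theta>_def .
qed

end
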